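(* Let $S\subset\mathbb{R}^d$ be a bounded set, $M\in\mathbb{S}^{n\times n}_{++}$, and $A(\sigma)=A_0+\sum_{m=1}^d\sigma_mA_m$ with $A_0,\dots,A_d\in\mathbb{S}^{n\times n}$ and $A(\sigma)\in\mathbb{S}^{n\times n}_{++}$ for all $\sigma\in S$. Assume that $A:S\to\mathbb{S}^{n\times n}_{++}$ is spectrally equivalent to $\overline{A}\in\mathbb{S}^{n\times n}_{++}$ with constants $\alpha,\beta>0$. Let $\Lambda>0$ and let $\rho>1$ satisfy $\alpha\rho>1$. Let $\sigma\in S$ and let $(\lambda(\sigma),x(\sigma))\in(0,\Lambda)\times(\mathbb{R}^n\setminus\{0\})$ satisfy $A(\sigma)x(\sigma)=\lambda(\sigma)Mx(\sigma)$. Let $W_\perp$ be a matrix whose columns form a basis of $\overline{E}_{\le\rho\Lambda}^\perp$. Then there is $\overline{x}(\sigma)\in\overline{E}_{\le\rho\Lambda}$ such that $$x(\sigma)=\overline{x}(\sigma)-Z(\sigma,\lambda(\sigma))\,\overline{x}(\sigma),$$ where the correction operator $Z:S\times(0,\Lambda)\to\mathbb{R}^{n\times n}$ is defined by $$Z(\sigma,t)=W_\perp\big(W_\perp^T(A(\sigma)-tM)W_\perp\big)^{-1}W_\perp^T\,\delta A(\sigma),\qquad \delta A(\sigma)=A(\sigma)-\overline{A}.$$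
   Context: $\mathbb{S}^{n\times n}$ denotes the real symmetric $n\times n$ matrices and $\mathbb{S}^{n\times n}_{++}$ the symmetric positive definite ones. Spectral equivalence with constants $\alpha,\beta>0$: $\alpha\,v^T\overline{A}v\le v^TA(\sigma)v\le\beta\,v^T\overline{A}v$ for all $v\in\mathbb{R}^n$ and $\sigma\in S$. $\overline{E}_{\le\rho\Lambda}$ is the span of all eigenvectors of $\overline{A}v=yMv$ with eigenvalue $y\in(0,\rho\Lambda)$, and $\overline{E}_{\le\rho\Lambda}^\perp=\{v\in\mathbb{R}^n: v^T\overline{A}w=0\ \text{for all } w\in\overline{E}_{\le\rho\Lambda}\}$ is its $\overline{A}$-orthogonal complement. The matrix $W_\perp^T(A(\sigma)-tM)W_\perp$ is positive definite for $(\sigma,t)\in S\times(0,\Lambda)$, so $Z$ is well defined. *)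

theory Defs
  imports
    Complex_Main
    "Jordan_Normal_Form.Gauss_Jordan_Elimination"
    "Jordan_Normal_Form.VS_Connect"
begin

text \<open>
  Vectors and matrices carry their dimensions as natural numbers, since the number of columns of
  \<open>W\<close> below is the dimension of a subspace and may be \<open>0\<close>.
\<close>

definition sym_mats :: "nat \<Rightarrow> real mat set" where
  "sym_mats n = {A \<in> carrier_mat n n. A\<^sup>T = A}"

definition spd_mats :: "nat \<Rightarrow> real mat set" where
  "spd_mats n =
     {A \<in> sym_mats n. \<forall>v \<in> carrier_vec n. v \<noteq> 0\<^sub>v n \<longrightarrow> 0 < v \<bullet> (A *\<^sub>v v)}"

definition bounded_in_Rn :: "nat \<Rightarrow> real vec set \<Rightarrow> bool" where
  "bounded_in_Rn d S \<longleftrightarrow> S \<subseteq> carrier_vec d \<and> bdd_above ((\<lambda>\<sigma>. sqrt (\<sigma> \<bullet> \<sigma>)) ` S)"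

text \<open>
  \<open>A\<^sub>0 + (\<Sum>m = 1..d. \<sigma>\<^sub>m A\<^sub>m)\<close>; the entries of a vector are numbered from \<open>0\<close>, so \<open>\<sigma>\<^sub>m\<close> is
  \<open>\<sigma> $ (m - 1)\<close>.
\<close>

definition affine_mat :: "nat \<Rightarrow> nat \<Rightarrow> (nat \<Rightarrow> real mat) \<Rightarrow> real vec \<Rightarrow> real mat" where
  "affine_mat n d A \<sigma> =
     A 0 + (\<Oplus>\<^bsub>module_mat TYPE(real) n n\<^esub> m \<in> {1..d}. (\<sigma> $ (m - 1)) \<cdot>\<^sub>m A m)"

definition spectrally_equivalent ::
  "nat \<Rightarrow> real vec set \<Rightarrow> (real vec \<Rightarrow> real mat) \<Rightarrow> real mat \<Rightarrow> real \<Rightarrow> real \<Rightarrow> bool" where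
  "spectrally_equivalent n S A Abar \<alpha> \<beta> \<longleftrightarrow>
     (\<forall>v \<in> carrier_vec n. \<forall>\<sigma> \<in> S.
        \<alpha> * (v \<bullet> (Abar *\<^sub>v v)) \<le> v \<bullet> (A \<sigma> *\<^sub>v v) \<and>
        v \<bullet> (A \<sigma> *\<^sub>v v) \<le> \<beta> * (v \<bullet> (Abar *\<^sub>v v)))"

abbreviation span_Rn :: "nat \<Rightarrow> real vec set \<Rightarrow> real vec set" where
  "span_Rn n \<equiv> LinearCombinations.module.span class_ring (module_vec TYPE(real) n)"

abbreviation lin_indpt_Rn :: "nat \<Rightarrow> real vec set \<Rightarrow> bool" where
  "lin_indpt_Rn n X \<equiv>
     \<not> LinearCombinations.module.lin_dep class_ring (module_vec TYPE(real) n) X"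

text \<open>Generalized eigenvectors of \<open>Abar v = y M v\<close> with \<open>0 < y < r\<close>, and their span.\<close>

definition Ebar :: "nat \<Rightarrow> real mat \<Rightarrow> real mat \<Rightarrow> real \<Rightarrow> real vec set" where
  "Ebar n Abar M r =
     span_Rn n {v \<in> carrier_vec n. v \<noteq> 0\<^sub>v n \<and>
                  (\<exists>y. 0 < y \<and> y < r \<and> Abar *\<^sub>v v = y \<cdot>\<^sub>v (M *\<^sub>v v))}"

definition Ebar_perp :: "nat \<Rightarrow> real mat \<Rightarrow> real mat \<Rightarrow> real \<Rightarrow> real vec set" where
  "Ebar_perp n Abar M r =
     {v \<in> carrier_vec n. \<forall>w \<in> Ebar n Abar M r. v \<bullet> (Abar *\<^sub>v w) = 0}"

text \<open>
  The columns are taken as a family, hence the distinctness requirement on the list of columns.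
\<close>

definition columns_form_basis :: "nat \<Rightarrow> real mat \<Rightarrow> real vec set \<Rightarrow> bool" where
  "columns_form_basis n W U \<longleftrightarrow>
     dim_row W = n \<and> distinct (cols W) \<and> lin_indpt_Rn n (set (cols W)) \<and>
     span_Rn n (set (cols W)) = U"

text \<open>
  \<open>mat_inverse\<close> returns \<open>None\<close> exactly on singular matrices, and \<open>the None\<close> is unspecified.
\<close>

definition correction_op ::
  "(real vec \<Rightarrow> real mat) \<Rightarrow> real mat \<Rightarrow> real mat \<Rightarrow> real mat \<Rightarrow> real vec \<Rightarrow> real \<Rightarrow> real mat" where
  "correction_op A Abar M W \<sigma> t =
     W * the (mat_inverse (W\<^sup>T * (A \<sigma> - t \<cdot>\<^sub>m M) * W)) * W\<^sup>T * (A \<sigma> - Abar)"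

end

theory Submission
  imports Defs "Jordan_Normal_Form.DL_Rank"
begin

text \<open>
  Split \<open>x = e + u\<close> with \<open>e\<close> in \<open>Ebar\<close> and \<open>u\<close> in its \<open>Abar\<close>-orthogonal complement. Testing
  \<open>(A - \<lambda> M) x = 0\<close> against the columns of \<open>W\<close> gives
  \<open>W\<^sup>T (A - \<lambda> M) u = - W\<^sup>T (A - Abar) e\<close>, because \<open>Ebar\<close> and its complement are orthogonal with
  respect to both \<open>Abar\<close> and \<open>M\<close>. The compressed matrix is invertible: on the complement the
  Rayleigh quotient of \<open>(Abar, M)\<close> is at least \<open>\<rho> \<Lambda>\<close>, hence that of \<open>(A, M)\<close> is at least
  \<open>\<alpha> \<rho> \<Lambda> > \<Lambda>\<close>.
\<close>

section \<open>Symmetric and positive definite matrices as bilinear forms\<close>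

lemma sym_matsD:
  assumes "A \<in> sym_mats n"
  shows "A \<in> carrier_mat n n" "A\<^sup>T = A"
  using assms by (auto simp: sym_mats_def)

lemma spd_matsD:
  assumes "A \<in> spd_mats n"
  shows "A \<in> sym_mats n" "A \<in> carrier_mat n n"
    "\<And>v. v \<in> carrier_vec n \<Longrightarrow> v \<noteq> 0\<^sub>v n \<Longrightarrow> 0 < v \<bullet> (A *\<^sub>v v)"
  using assms by (auto simp: spd_mats_def sym_mats_def)

lemma spd_mats_nonneg:
  assumes "A \<in> spd_mats n" "v \<in> carrier_vec n"
  shows "0 \<le> v \<bullet> (A *\<^sub>v v)"
proof (cases "v = 0\<^sub>v n")
  case True
  then show ?thesis
    using mult_mat_vec_carrier[OF spd_matsD(2)[OF assms(1)] assms(2)] by simp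
next
  case False
  then show ?thesis using spd_matsD(3)[OF assms(1,2)] by (simp add: less_imp_le)
qed

lemma mult_mat_vec_scalar_prod:
  fixes W :: "'a :: comm_semiring_0 mat"
  assumes "W \<in> carrier_mat n k" "c \<in> carrier_vec k" "z \<in> carrier_vec n"
  shows "(W *\<^sub>v c) \<bullet> z = c \<bullet> (W\<^sup>T *\<^sub>v z)"
  using transpose_vec_mult_scalar[OF assms]
    comm_scalar_prod[of "W *\<^sub>v c" n z] comm_scalar_prod[of "W\<^sup>T *\<^sub>v z" k c] assms by simp

lemma sym_mats_scalar_prod_commute:
  assumes "A \<in> sym_mats n" "u \<in> carrier_vec n" "v \<in> carrier_vec n"
  shows "u \<bullet> (A *\<^sub>v v) = v \<bullet> (A *\<^sub>v u)"
proof -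
  note A = sym_matsD[OF assms(1)]
  have "u \<bullet> (A *\<^sub>v v) = (A *\<^sub>v u) \<bullet> v"
    using mult_mat_vec_scalar_prod[OF A(1) assms(2,3)] A(2) by simp
  also have "\<dots> = v \<bullet> (A *\<^sub>v u)"
    by (rule comm_scalar_prod[of _ n]) (use A(1) assms in auto)
  finally show ?thesis .
qed

lemma scalar_prod_real_eq_0:
  fixes v :: "real Matrix.vec"
  assumes "v \<in> carrier_vec n" "v \<bullet> v = 0"
  shows "v = 0\<^sub>v n"
  using conjugate_square_eq_0_vec[OF assms(1)] assms(2) by simp

lemma scalar_prod_real_nonneg: "0 \<le> (v :: real Matrix.vec) \<bullet> v"
  using conjugate_square_ge_0_vec[of v] by simp

lemma vec_eq_0_if_orthogonal_all:
  fixes v :: "real Matrix.vec"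
  assumes "v \<in> carrier_vec n" "\<And>w. w \<in> carrier_vec n \<Longrightarrow> w \<bullet> v = 0"
  shows "v = 0\<^sub>v n"
  using scalar_prod_real_eq_0 assms by blast

lemma vec_minus_eq_0D:
  fixes v w :: "'a :: group_add Matrix.vec"
  assumes "v \<in> carrier_vec n" "w \<in> carrier_vec n" "v - w = 0\<^sub>v n"
  shows "v = w"
proof (rule eq_vecI)
  show "dim_vec v = dim_vec w" using assms by simp
  fix i assume "i < dim_vec w"
  then have "(v - w) $ i = v $ i - w $ i" "i < n" using assms(1,2) by auto
  then show "v $ i = w $ i" using assms(3) by simp
qed

lemma quadratic_form_add_smult:
  assumes A: "A \<in> sym_mats n" and u: "u \<in> carrier_vec n" and v: "v \<in> carrier_vec n"
  shows "(u + t \<cdot>\<^sub>v v) \<bullet> (A *\<^sub>v (u + t \<cdot>\<^sub>v v)) =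
    u \<bullet> (A *\<^sub>v u) + 2 * t * (u \<bullet> (A *\<^sub>v v)) + t\<^sup>2 * (v \<bullet> (A *\<^sub>v v))"
proof -
  note A1 = sym_matsD(1)[OF A]
  have c: "A *\<^sub>v u \<in> carrier_vec n" "A *\<^sub>v v \<in> carrier_vec n" using A1 u v by auto
  have "A *\<^sub>v (u + t \<cdot>\<^sub>v v) = A *\<^sub>v u + t \<cdot>\<^sub>v (A *\<^sub>v v)"
    using A1 u v by (simp add: mult_add_distrib_mat_vec[of _ n n] mult_mat_vec[of _ n n])
  then have "(u + t \<cdot>\<^sub>v v) \<bullet> (A *\<^sub>v (u + t \<cdot>\<^sub>v v)) =
      u \<bullet> (A *\<^sub>v u) + t * (u \<bullet> (A *\<^sub>v v)) + t * (v \<bullet> (A *\<^sub>v u)) + t * t * (v \<bullet> (A *\<^sub>v v))"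
    using c u v by (simp add: add_scalar_prod_distrib[of _ n] scalar_prod_add_distrib[of _ n]
        smult_scalar_prod_distrib[of _ n] scalar_prod_smult_distrib[of _ n] algebra_simps)
  then show ?thesis
    using sym_mats_scalar_prod_commute[OF A u v] by (simp add: power2_eq_square)
qed

section \<open>Cauchy-Schwarz, inverses and coercivity\<close>

text \<open>The form is nonnegative along the line \<open>u + t \<cdot>\<^sub>v v\<close>, so a
  suitable \<open>t\<close> gives the bound. Since \<open>A\<close> is only semidefinite,
  \<open>v\<close> may be a null direction and needs its own case.\<close>

lemma psd_Cauchy_Schwarz:
  assumes A: "A \<in> sym_mats n"
    and psd: "\<And>v. v \<in> carrier_vec n \<Longrightarrow> 0 \<le> v \<bullet> (A *\<^sub>v v)"
    and u: "u \<in> carrier_vec n" and v: "v \<in> carrier_vec n"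
  shows "(u \<bullet> (A *\<^sub>v v))\<^sup>2 \<le> (u \<bullet> (A *\<^sub>v u)) * (v \<bullet> (A *\<^sub>v v))"
proof -
  let ?a = "u \<bullet> (A *\<^sub>v u)" and ?b = "u \<bullet> (A *\<^sub>v v)" and ?c = "v \<bullet> (A *\<^sub>v v)"
  have q: "0 \<le> ?a + 2 * t * ?b + t\<^sup>2 * ?c" for t
    using psd[of "u + t \<cdot>\<^sub>v v"] quadratic_form_add_smult[OF A u v, of t] u v by simp
  have c0: "0 \<le> ?c" using psd v by simp
  show ?thesis
  proof (cases "?c = 0")
    case True
    have "?b = 0"
    proof (rule ccontr)
      assume b: "?b \<noteq> 0"
      \<comment> \<open>For \<open>?c = 0\<close> the expression is affine in \<open>t\<close>, and
        this \<open>t\<close> is where it takes the value -1.\<close>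
      have "0 \<le> ?a + 2 * (- (?a + 1) / (2 * ?b)) * ?b" using q[of "- (?a + 1) / (2 * ?b)"] True by simp
      also have "\<dots> = -1" using b by (simp add: field_simps)
      finally show False by simp
    qed
    then show ?thesis using True by simp
  next
    case False
    then have c: "0 < ?c" using c0 by simp
    \<comment> \<open>\<open>- ?b / ?c\<close> is the minimizer of the quadratic in
      \<open>t\<close>.\<close>
    have "0 \<le> ?a + 2 * (- ?b / ?c) * ?b + (- ?b / ?c)\<^sup>2 * ?c" by (rule q)
    also have "\<dots> = ?a - ?b\<^sup>2 / ?c" using c by (simp add: field_simps power2_eq_square)
    finally show ?thesis using c by (simp add: field_simps)
  qed
qed

text \<open>Cauchy-Schwarz makes \<open>A *\<^sub>v v\<close> orthogonal to every
  \<open>u\<close>.\<close>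

lemma psd_kernel:
  assumes A: "A \<in> sym_mats n"
    and psd: "\<And>v. v \<in> carrier_vec n \<Longrightarrow> 0 \<le> v \<bullet> (A *\<^sub>v v)"
    and v: "v \<in> carrier_vec n" and "v \<bullet> (A *\<^sub>v v) = 0"
  shows "A *\<^sub>v v = 0\<^sub>v n"
proof (rule vec_eq_0_if_orthogonal_all)
  show "A *\<^sub>v v \<in> carrier_vec n" using sym_matsD(1)[OF A] v by simp
  show "u \<bullet> (A *\<^sub>v v) = 0" if "u \<in> carrier_vec n" for u
    using psd_Cauchy_Schwarz[OF A psd that v] assms(4) by simp
qed

text \<open>A nonzero kernel vector would have zero quadratic form, so the determinant is nonzero
  and \<open>mat_inverse\<close> cannot return \<open>None\<close>. The size \<open>n = 0\<close> is
  included.\<close>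

lemma spd_mat_inverse:
  assumes A: "A \<in> spd_mats n"
  obtains B where "mat_inverse A = Some B" "B \<in> carrier_mat n n" "A * B = 1\<^sub>m n" "B * A = 1\<^sub>m n"
proof -
  note A1 = spd_matsD(2)[OF A]
  have "det A \<noteq> 0"
  proof
    assume "det A = 0"
    then obtain v where v: "v \<in> carrier_vec n" "v \<noteq> 0\<^sub>v n" "A *\<^sub>v v = 0\<^sub>v n"
      using det_0_iff_vec_prod_zero_field[OF A1] by blast
    then show False using spd_matsD(3)[OF A v(1,2)] by simp
  qed
  then have "mat_inverse A \<noteq> None"
    using mat_inverse(1)[OF A1, of "()"] det_non_zero_imp_unit[OF A1, of "()"] by blast
  then obtain B where B: "mat_inverse A = Some B" by blast
  with mat_inverse(2)[OF A1 B] that show ?thesis by blast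
qed

text \<open>The sum of the absolute values of the entries bounds the form; adding 1 keeps the
  constant positive even for \<open>R = 0\<close> or \<open>n = 0\<close>.\<close>

lemma quadratic_form_le:
  fixes R :: "real mat"
  assumes R: "R \<in> carrier_mat n n"
  obtains K where "0 < K" "\<And>v. v \<in> carrier_vec n \<Longrightarrow> v \<bullet> (R *\<^sub>v v) \<le> K * (v \<bullet> v)"
proof
  let ?K = "\<Sum>i<n. \<Sum>j<n. \<bar>R $$ (i, j)\<bar>"
  show "0 < ?K + 1"
    by (intro add_nonneg_pos sum_nonneg) auto
  fix v :: "real Matrix.vec" assume v: "v \<in> carrier_vec n"
  have sq: "v $ i * v $ i \<le> v \<bullet> v" if "i < n" for i
    using that v by (auto simp: scalar_prod_def intro: member_le_sum)
  have summand: "v $ i * (R $$ (i, j) * v $ j) \<le> \<bar>R $$ (i, j)\<bar> * (v \<bullet> v)" if "i < n" "j < n" for i j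
  proof -
    \<comment> \<open>Twice a product is at most the sum of the two squares; this is used for both
      signs of \<open>v $ i\<close>.\<close>
    have "v $ i * v $ j \<le> v \<bullet> v" "- (v $ i * v $ j) \<le> v \<bullet> v"
      using sq[OF that(1)] sq[OF that(2)] sum_squares_bound[of "v $ i" "v $ j"]
        sum_squares_bound[of "- (v $ i)" "v $ j"] by (simp_all add: power2_eq_square)
    then have "\<bar>v $ i * v $ j\<bar> \<le> v \<bullet> v" by simp
    then have "\<bar>R $$ (i, j)\<bar> * \<bar>v $ i * v $ j\<bar> \<le> \<bar>R $$ (i, j)\<bar> * (v \<bullet> v)"
      by (rule mult_left_mono) simp
    moreover have "v $ i * (R $$ (i, j) * v $ j) \<le> \<bar>R $$ (i, j)\<bar> * \<bar>v $ i * v $ j\<bar>"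
      unfolding abs_mult[symmetric] by (simp add: ac_simps)
    ultimately show ?thesis by linarith
  qed
  have "v \<bullet> (R *\<^sub>v v) = (\<Sum>i<n. \<Sum>j<n. v $ i * (R $$ (i, j) * v $ j))"
    using R v by (simp add: scalar_prod_def sum_distrib_left atLeast0LessThan)
  also have "\<dots> \<le> (\<Sum>i<n. \<Sum>j<n. \<bar>R $$ (i, j)\<bar> * (v \<bullet> v))"
    by (intro sum_mono summand) auto
  also have "\<dots> = ?K * (v \<bullet> v)" by (simp add: sum_distrib_right)
  also have "\<dots> \<le> (?K + 1) * (v \<bullet> v)"
    using scalar_prod_real_nonneg[of v] by (simp add: distrib_right)
  finally show "v \<bullet> (R *\<^sub>v v) \<le> (?K + 1) * (v \<bullet> v)" .
qed

text \<open>Cauchy-Schwarz for \<open>Q\<close>, applied to \<open>v\<close> and the preimage of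
  \<open>v\<close> under \<open>Q\<close>, combined with the upper bound for the inverse. This
  replaces a compactness argument on the unit sphere.\<close>

lemma spd_coercive:
  assumes Q: "Q \<in> spd_mats n"
  obtains K where "0 < K" "\<And>v. v \<in> carrier_vec n \<Longrightarrow> v \<bullet> v \<le> K * (v \<bullet> (Q *\<^sub>v v))"
proof -
  note Q1 = spd_matsD(2)[OF Q]
  obtain B where B: "B \<in> carrier_mat n n" "Q * B = 1\<^sub>m n"
    using spd_mat_inverse[OF Q] by metis
  obtain K where K: "0 < K" "\<And>v. v \<in> carrier_vec n \<Longrightarrow> v \<bullet> (B *\<^sub>v v) \<le> K * (v \<bullet> v)"
    using quadratic_form_le[OF B(1)] by metis
  have "v \<bullet> v \<le> K * (v \<bullet> (Q *\<^sub>v v))" if v: "v \<in> carrier_vec n" for v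
  proof (cases "v = 0\<^sub>v n")
    case True
    then show ?thesis using mult_mat_vec_carrier[OF Q1 v] by simp
  next
    case False
    then have pos: "0 < v \<bullet> v"
      using scalar_prod_real_eq_0[OF v] scalar_prod_real_nonneg[of v] by fastforce
    have Bv: "B *\<^sub>v v \<in> carrier_vec n" using B v by simp
    have QB: "Q *\<^sub>v (B *\<^sub>v v) = v"
      using assoc_mult_mat_vec[OF Q1 B(1) v] B(2) v by simp
    have "(v \<bullet> v)\<^sup>2 \<le> (v \<bullet> (Q *\<^sub>v v)) * ((B *\<^sub>v v) \<bullet> v)"
      using psd_Cauchy_Schwarz[OF spd_matsD(1)[OF Q] spd_mats_nonneg[OF Q] v Bv] QB by simp
    also have "(B *\<^sub>v v) \<bullet> v = v \<bullet> (B *\<^sub>v v)" by (rule comm_scalar_prod[OF Bv v])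
    also have "(v \<bullet> (Q *\<^sub>v v)) * (v \<bullet> (B *\<^sub>v v)) \<le> (v \<bullet> (Q *\<^sub>v v)) * (K * (v \<bullet> v))"
      by (rule mult_left_mono[OF K(2)[OF v] spd_mats_nonneg[OF Q v]])
    finally have "(v \<bullet> v) * (v \<bullet> v) \<le> (K * (v \<bullet> (Q *\<^sub>v v))) * (v \<bullet> v)"
      by (simp add: power2_eq_square ac_simps)
    then show ?thesis using pos by (rule mult_right_le_imp_le)
  qed
  with K(1) that show ?thesis by blast
qed

section \<open>Eigenvalues of a pair of positive definite matrices\<close>

lemma scalar_prod_minus_smult_mult_mat_vec:
  fixes B N :: "real mat"
  assumes "B \<in> carrier_mat n n" "N \<in> carrier_mat n n" "u \<in> carrier_vec n" "v \<in> carrier_vec n"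
  shows "u \<bullet> ((B - c \<cdot>\<^sub>m N) *\<^sub>v v) = u \<bullet> (B *\<^sub>v v) - c * (u \<bullet> (N *\<^sub>v v))"
proof -
  have "(c \<cdot>\<^sub>m N) *\<^sub>v v = c \<cdot>\<^sub>v (N *\<^sub>v v)"
    using assms by (intro eq_vecI) auto
  then have "(B - c \<cdot>\<^sub>m N) *\<^sub>v v = B *\<^sub>v v - c \<cdot>\<^sub>v (N *\<^sub>v v)"
    using assms by (simp add: minus_mult_distrib_mat_vec[of _ n n])
  then show ?thesis
    using assms by (simp add: scalar_prod_minus_distrib[of _ n] scalar_prod_smult_distrib[of _ n])
qed

lemma sym_mats_minus_smult:
  assumes "B \<in> sym_mats n" "N \<in> sym_mats n"
  shows "B - c \<cdot>\<^sub>m N \<in> sym_mats n"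
proof -
  note B = sym_matsD[OF assms(1)] and N = sym_matsD[OF assms(2)]
  have "(c \<cdot>\<^sub>m N)\<^sup>T = c \<cdot>\<^sub>m N\<^sup>T" using N(1) by (intro eq_matI) auto
  then show ?thesis
    using B N transpose_minus[of B n n "c \<cdot>\<^sub>m N"] minus_carrier_mat[of "c \<cdot>\<^sub>m N" n n B]
    by (simp add: sym_mats_def)
qed

text \<open>
  The eigenvalue is the largest \<open>c\<close> for which \<open>B - c N\<close> is positive semidefinite. If \<open>B - c N\<close>
  had trivial kernel, it would be coercive and \<open>c\<close> could still be increased.
\<close>

lemma generalized_eigenvector_below_Rayleigh_quotient:
  assumes B: "B \<in> spd_mats n" and N: "N \<in> spd_mats n"
    and w: "w \<in> carrier_vec n" "w \<bullet> (B *\<^sub>v w) < r * (w \<bullet> (N *\<^sub>v w))"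
  obtains y v where "0 < y" "y < r" "v \<in> carrier_vec n" "v \<noteq> 0\<^sub>v n"
    "B *\<^sub>v v = y \<cdot>\<^sub>v (N *\<^sub>v v)"
proof -
  note B1 = spd_matsD[OF B] and N1 = spd_matsD[OF N]
  note form = scalar_prod_minus_smult_mult_mat_vec[OF B1(2) N1(2)]
  define T where "T = {c. \<forall>v \<in> carrier_vec n. c * (v \<bullet> (N *\<^sub>v v)) \<le> v \<bullet> (B *\<^sub>v v)}"
  define y where "y = Sup T"
  have w0: "w \<noteq> 0\<^sub>v n"
    using w mult_mat_vec_carrier[OF B1(2) w(1)] mult_mat_vec_carrier[OF N1(2) w(1)] by auto
  have Nw: "0 < w \<bullet> (N *\<^sub>v w)" using N1(3)[OF w(1) w0] .
  \<comment> \<open>The Rayleigh quotient of \<open>w\<close> bounds \<open>T\<close> from above,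
    which keeps the supremum \<open>y\<close> finite and below \<open>r\<close>.\<close>
  define q where "q = w \<bullet> (B *\<^sub>v w) / (w \<bullet> (N *\<^sub>v w))"
  have q: "q < r" using w(2) Nw by (simp add: q_def field_simps)
  have Tq: "c \<le> q" if "c \<in> T" for c
    using that w(1) Nw by (simp add: T_def q_def field_simps)
  have "0 \<in> T" using spd_mats_nonneg[OF B] by (simp add: T_def)
  have yq: "y \<le> q" unfolding y_def using \<open>0 \<in> T\<close> Tq by (intro cSup_least) auto
  have up: "c \<le> y" if "c \<in> T" for c
    unfolding y_def using that Tq by (intro cSup_upper bdd_aboveI)
  \<comment> \<open>The supremum is attained: each nonzero \<open>v\<close> bounds the members of
    \<open>T\<close> by its own Rayleigh quotient, and this bound passes to
    \<open>y\<close>.\<close>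
  have yT: "y \<in> T"
    unfolding T_def
  proof (intro CollectI ballI)
    fix v :: "real Matrix.vec" assume v: "v \<in> carrier_vec n"
    show "y * (v \<bullet> (N *\<^sub>v v)) \<le> v \<bullet> (B *\<^sub>v v)"
    proof (cases "v = 0\<^sub>v n")
      case True
      then show ?thesis
        using mult_mat_vec_carrier[OF B1(2) v] mult_mat_vec_carrier[OF N1(2) v] by simp
    next
      case False
      then have Nv: "0 < v \<bullet> (N *\<^sub>v v)" using N1(3) v by simp
      have "y \<le> v \<bullet> (B *\<^sub>v v) / (v \<bullet> (N *\<^sub>v v))"
        unfolding y_def
      proof (rule cSup_least)
        show "c \<le> v \<bullet> (B *\<^sub>v v) / (v \<bullet> (N *\<^sub>v v))" if "c \<in> T" for c
          using that v Nv by (simp add: T_def pos_le_divide_eq)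
      qed (use \<open>0 \<in> T\<close> in blast)
      then show ?thesis using Nv by (simp add: field_simps)
    qed
  qed
  let ?Q = "B - y \<cdot>\<^sub>m N"
  have Qsym: "?Q \<in> sym_mats n" by (rule sym_mats_minus_smult[OF B1(1) N1(1)])
  have psd: "0 \<le> v \<bullet> (?Q *\<^sub>v v)" if "v \<in> carrier_vec n" for v
    using that yT form[OF that that] by (simp add: T_def)
  have "?Q \<notin> spd_mats n"
  proof
    assume Q: "?Q \<in> spd_mats n"
    obtain K where K: "0 < K" "\<And>v. v \<in> carrier_vec n \<Longrightarrow> v \<bullet> v \<le> K * (v \<bullet> (?Q *\<^sub>v v))"
      using spd_coercive[OF Q] by metis
    obtain L where L: "0 < L" "\<And>v. v \<in> carrier_vec n \<Longrightarrow> v \<bullet> (N *\<^sub>v v) \<le> L * (v \<bullet> v)"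
      using quadratic_form_le[OF N1(2)] by metis
    \<comment> \<open>As quadratic forms \<open>N\<close> is at most \<open>L * K\<close> times
      \<open>?Q\<close>, so subtracting a further \<open>1 / (L * K)\<close> times \<open>N\<close>
      from \<open>?Q\<close> leaves it nonnegative.\<close>
    have "y + 1 / (L * K) \<in> T"
      unfolding T_def
    proof (intro CollectI ballI)
      fix v :: "real Matrix.vec" assume v: "v \<in> carrier_vec n"
      have "v \<bullet> (N *\<^sub>v v) \<le> L * (K * (v \<bullet> (?Q *\<^sub>v v)))"
        using L(2)[OF v] mult_left_mono[OF K(2)[OF v] less_imp_le[OF L(1)]] by linarith
      then have "v \<bullet> (N *\<^sub>v v) / (L * K) \<le> v \<bullet> (?Q *\<^sub>v v)"
        using L(1) K(1) by (simp add: divide_le_eq ac_simps)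
      then show "(y + 1 / (L * K)) * (v \<bullet> (N *\<^sub>v v)) \<le> v \<bullet> (B *\<^sub>v v)"
        unfolding form[OF v v] by (simp add: distrib_right)
    qed
    from up[OF this] mult_pos_pos[OF L(1) K(1)] show False by (simp add: divide_le_0_iff)
  qed
  then obtain v where v: "v \<in> carrier_vec n" "v \<noteq> 0\<^sub>v n" "\<not> 0 < v \<bullet> (?Q *\<^sub>v v)"
    using Qsym by (auto simp: spd_mats_def)
  then have zero: "v \<bullet> (?Q *\<^sub>v v) = 0" using psd[OF v(1)] by simp
  have ker: "?Q *\<^sub>v v = 0\<^sub>v n" by (rule psd_kernel[OF Qsym psd v(1) zero])
  have "B *\<^sub>v v - y \<cdot>\<^sub>v (N *\<^sub>v v) = 0\<^sub>v n"
  proof (rule vec_eq_0_if_orthogonal_all)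
    show "B *\<^sub>v v - y \<cdot>\<^sub>v (N *\<^sub>v v) \<in> carrier_vec n" using B1(2) N1(2) v(1) by simp
    fix u :: "real Matrix.vec" assume u: "u \<in> carrier_vec n"
    show "u \<bullet> (B *\<^sub>v v - y \<cdot>\<^sub>v (N *\<^sub>v v)) = 0"
      using form[OF u v(1), of y] ker u B1(2) N1(2) v(1)
      by (simp add: scalar_prod_minus_distrib[of _ n] scalar_prod_smult_distrib[of _ n])
  qed
  then have eig: "B *\<^sub>v v = y \<cdot>\<^sub>v (N *\<^sub>v v)"
    by (rule vec_minus_eq_0D[rotated 2]) (use B1(2) N1(2) v(1) in auto)
  \<comment> \<open>Membership of 0 in \<open>T\<close> only yields \<open>0 \<le> y\<close>;
    strictness comes from the definiteness of \<open>B\<close> at the eigenvector.\<close>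
  have "0 < y * (v \<bullet> (N *\<^sub>v v))"
    using zero form[OF v(1) v(1)] B1(3)[OF v(1,2)] by simp
  then have "0 < y" using N1(3)[OF v(1,2)] by (simp add: zero_less_mult_iff)
  with yq q v eig that show ?thesis by force
qed

section \<open>Congruence transforms and column spaces\<close>

lemma sym_mats_congruence:
  assumes Q: "Q \<in> sym_mats n" and W: "W \<in> carrier_mat n k"
  shows "W\<^sup>T * Q * W \<in> sym_mats k"
proof -
  note Q = sym_matsD[OF Q]
  have "(W\<^sup>T * Q * W)\<^sup>T = W\<^sup>T * (W\<^sup>T * Q)\<^sup>T"
    by (rule transpose_mult[of _ k n _ k]) (use Q W in auto)
  also have "(W\<^sup>T * Q)\<^sup>T = Q * W"
    using transpose_mult[of "W\<^sup>T" k n Q n] Q W by simp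
  also have "W\<^sup>T * (Q * W) = W\<^sup>T * Q * W"
    by (rule assoc_mult_mat[of _ k n _ n _ k, symmetric]) (use Q W in auto)
  finally show ?thesis using Q W by (simp add: sym_mats_def)
qed

lemma congruence_scalar_prod:
  fixes Q :: "'a :: comm_semiring_0 mat"
  assumes Q: "Q \<in> carrier_mat n n" and W: "W \<in> carrier_mat n k"
    and c: "c \<in> carrier_vec k" and e: "e \<in> carrier_vec k"
  shows "c \<bullet> ((W\<^sup>T * Q * W) *\<^sub>v e) = (W *\<^sub>v c) \<bullet> (Q *\<^sub>v (W *\<^sub>v e))"
proof -
  have "(W\<^sup>T * Q * W) *\<^sub>v e = (W\<^sup>T * Q) *\<^sub>v (W *\<^sub>v e)"
    by (rule assoc_mult_mat_vec[of _ k n _ k]) (use Q W e in auto)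
  also have "\<dots> = W\<^sup>T *\<^sub>v (Q *\<^sub>v (W *\<^sub>v e))"
    by (rule assoc_mult_mat_vec[of _ k n _ n]) (use Q W e in auto)
  finally show ?thesis
    using mult_mat_vec_scalar_prod[OF W c, of "Q *\<^sub>v (W *\<^sub>v e)"] Q W e by simp
qed

text \<open>Positivity is asked for on the range of \<open>W\<close> only, because
  \<open>A - lam M\<close> annihilates \<open>x\<close> and so is not definite on the whole
  space.\<close>

lemma spd_mats_congruence:
  assumes Q: "Q \<in> sym_mats n" and W: "W \<in> carrier_mat n k"
    and pos: "\<And>c. c \<in> carrier_vec k \<Longrightarrow> c \<noteq> 0\<^sub>v k \<Longrightarrow> 0 < (W *\<^sub>v c) \<bullet> (Q *\<^sub>v (W *\<^sub>v c))"
  shows "W\<^sup>T * Q * W \<in> spd_mats k"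
  using sym_mats_congruence[OF Q W] pos congruence_scalar_prod[OF sym_matsD(1)[OF Q] W]
  by (simp add: spd_mats_def)

lemma lin_indpt_cols_injective:
  fixes W :: "real mat"
  assumes "W \<in> carrier_mat n k" "distinct (cols W)" "lin_indpt_Rn n (set (cols W))"
    and "c \<in> carrier_vec k" "W *\<^sub>v c = 0\<^sub>v n"
  shows "c = 0\<^sub>v k"
  using vec_space.lin_depI[OF assms(1,4) _ assms(5,2)] assms(3) by blast

text \<open>Translates the basis condition, stated through spans, into coordinate vectors.\<close>

lemma span_cols_eq_range:
  fixes W :: "real mat"
  assumes W: "W \<in> carrier_mat n k" and dist: "distinct (cols W)"
  shows "span_Rn n (set (cols W)) = (\<lambda>c. W *\<^sub>v c) ` carrier_vec k"
proof -
  interpret vec_space "TYPE(real)" n .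
  have sub: "set (cols W) \<subseteq> carrier_vec n" using W cols_dim by blast
  have "span (set (cols W)) = {lincomb a (set (cols W)) |a. a \<in> set (cols W) \<rightarrow> UNIV}"
    using finite_span[of "set (cols W)"] sub by simp
  also have "\<dots> = (\<lambda>c. W *\<^sub>v c) ` carrier_vec k"
  proof (intro equalityI subsetI)
    fix v assume "v \<in> {lincomb a (set (cols W)) |a. a \<in> set (cols W) \<rightarrow> UNIV}"
    then obtain a where "v = lincomb a (set (cols W))" by blast
    then have "v = W *\<^sub>v vec k (\<lambda>i. a (col W i))" using mat_mult_eq_lincomb[OF W dist] by simp
    then show "v \<in> (\<lambda>c. W *\<^sub>v c) ` carrier_vec k" by auto
  next
    fix v assume "v \<in> (\<lambda>c. W *\<^sub>v c) ` carrier_vec k"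
    then obtain c where c: "c \<in> carrier_vec k" "v = W *\<^sub>v c" by blast
    show "v \<in> {lincomb a (set (cols W)) |a. a \<in> set (cols W) \<rightarrow> UNIV}"
      using lincomb_eq_mat_mult[OF W c(1) dist, symmetric] c(2) by blast
  qed
  finally show ?thesis .
qed

text \<open>The columns of \<open>V\<close> are a maximal linearly independent subset of
  \<open>X\<close>. It exists although \<open>X\<close> may be infinite, since independent sets have
  at most \<open>n\<close> elements.\<close>

lemma span_eq_range_injective:
  fixes X :: "real Matrix.vec set"
  assumes X: "X \<subseteq> carrier_vec n"
  obtains V k where "V \<in> carrier_mat n k" "span_Rn n X = (\<lambda>c. V *\<^sub>v c) ` carrier_vec k"
    "\<And>c. c \<in> carrier_vec k \<Longrightarrow> V *\<^sub>v c = 0\<^sub>v n \<Longrightarrow> c = 0\<^sub>v k"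
proof -
  interpret vec_space "TYPE(real)" n .
  have li: "finite L \<and> card L \<le> n" if "L \<subseteq> X \<and> lin_indpt L" for L
    using li_le_dim[of L] that X fin_dim dim_is_n by auto
  obtain L where L: "finite L" "maximal L (\<lambda>L. L \<subseteq> X \<and> lin_indpt L)"
  proof -
    have "lin_indpt {}" by (rule finite_lin_indpt2) auto
    then show ?thesis
      using maximal_exists[of "\<lambda>L. L \<subseteq> X \<and> lin_indpt L" n "{}"] li that by blast
  qed
  then have LX: "L \<subseteq> X" and Li: "lin_indpt L" by (auto simp: maximal_def)
  have Lc: "L \<subseteq> carrier_vec n" using LX X by blast
  have "X \<subseteq> span L"
  proof
    fix x assume x: "x \<in> X"
    show "x \<in> span L"
    proof (rule ccontr)
      assume nx: "x \<notin> span L"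
      then have "x \<notin> L" using in_own_span[of L] Lc by auto
      then have "lin_indpt (L \<union> {x})" using lin_dep_iff_in_span[of L x] Lc Li nx x X by auto
      then show False using L(2) LX x \<open>x \<notin> L\<close> unfolding maximal_def by blast
    qed
  qed
  then have sp: "span X = span L"
    using span_subsetI[OF Lc] span_is_monotone[OF LX] by blast
  obtain ls where ls: "set ls = L" "distinct ls" using finite_distinct_list[OF L(1)] by blast
  let ?V = "mat_of_cols n ls"
  have V: "?V \<in> carrier_mat n (length ls)" by simp
  have cV: "cols ?V = ls" using Lc ls by simp
  show ?thesis
  proof (rule that[OF V])
    show "span X = (\<lambda>c. ?V *\<^sub>v c) ` carrier_vec (length ls)"
      using span_cols_eq_range[OF V] cV ls sp by simp
    show "c = 0\<^sub>v (length ls)" if "c \<in> carrier_vec (length ls)" "?V *\<^sub>v c = 0\<^sub>v n" for c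
      using lin_indpt_cols_injective[OF V _ _ that] cV ls Li by simp
  qed
qed

section \<open>Orthogonal projection for a positive definite inner product\<close>

text \<open>\<open>e = V *\<^sub>v c\<close> solves the normal equations. Their Gram matrix
  \<open>V\<^sup>T * A * V\<close> is positive definite because \<open>V\<close> has trivial
  kernel.\<close>

lemma spd_orthogonal_decomposition:
  assumes A: "A \<in> spd_mats n" and X: "X \<subseteq> carrier_vec n" and x: "x \<in> carrier_vec n"
  obtains e u where "e \<in> span_Rn n X" "e \<in> carrier_vec n" "u \<in> carrier_vec n" "x = e + u"
    "\<And>w. w \<in> span_Rn n X \<Longrightarrow> u \<bullet> (A *\<^sub>v w) = 0"
proof -
  note A1 = spd_matsD[OF A]
  obtain V k where V: "V \<in> carrier_mat n k" and sp: "span_Rn n X = (\<lambda>c. V *\<^sub>v c) ` carrier_vec k"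
    and inj: "\<And>c. c \<in> carrier_vec k \<Longrightarrow> V *\<^sub>v c = 0\<^sub>v n \<Longrightarrow> c = 0\<^sub>v k"
    using span_eq_range_injective[OF X] by metis
  let ?G = "V\<^sup>T * A * V"
  have G: "?G \<in> spd_mats k"
    using inj V A1(3) by (intro spd_mats_congruence[OF A1(1) V]) fastforce
  note G1 = spd_matsD(2)[OF G]
  obtain B where B: "B \<in> carrier_mat k k" "?G * B = 1\<^sub>m k" using spd_mat_inverse[OF G] by metis
  define b where "b = V\<^sup>T *\<^sub>v (A *\<^sub>v x)"
  define c where "c = B *\<^sub>v b"
  have b: "b \<in> carrier_vec k" using V A1(2) x by (simp add: b_def)
  have c: "c \<in> carrier_vec k" using B b by (simp add: c_def)
  have Gc: "?G *\<^sub>v c = b"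
    using assoc_mult_mat_vec[OF G1 B(1) b] B(2) b by (simp add: c_def)
  have Vc: "V *\<^sub>v c \<in> carrier_vec n" using V c by simp
  let ?u = "x - V *\<^sub>v c"
  have u: "?u \<in> carrier_vec n" using x Vc by simp
  show ?thesis
  proof (rule that[of "V *\<^sub>v c" ?u])
    show "V *\<^sub>v c \<in> span_Rn n X" using sp c by simp
    show "x = V *\<^sub>v c + ?u" using x V c by (intro eq_vecI) auto
    fix w assume "w \<in> span_Rn n X"
    then obtain f where f: "f \<in> carrier_vec k" "w = V *\<^sub>v f" using sp by blast
    have w: "w \<in> carrier_vec n" using f V by simp
    have "?u \<bullet> (A *\<^sub>v w) = w \<bullet> (A *\<^sub>v ?u)" by (rule sym_mats_scalar_prod_commute[OF A1(1) u w])
    also have "\<dots> = w \<bullet> (A *\<^sub>v x) - w \<bullet> (A *\<^sub>v (V *\<^sub>v c))"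
      using A1(2) x Vc w
      by (simp add: mult_minus_distrib_mat_vec[of _ n n] scalar_prod_minus_distrib[of _ n])
    also have "w \<bullet> (A *\<^sub>v x) = f \<bullet> b"
      using mult_mat_vec_scalar_prod[OF V f(1)] A1(2) x by (simp add: f(2) b_def)
    also have "w \<bullet> (A *\<^sub>v (V *\<^sub>v c)) = f \<bullet> b"
      using congruence_scalar_prod[OF A1(2) V f(1) c] Gc f(2) by simp
    finally show "?u \<bullet> (A *\<^sub>v w) = 0" by simp
  qed (use u Vc in auto)
qed

section \<open>The low eigenspace and its complement\<close>

text \<open>The generating set of \<open>Ebar\<close>, written exactly as there so that
  \<open>Ebar_def\<close> folds and unfolds to its span.\<close>

abbreviation low_eigenvectors :: "nat \<Rightarrow> real mat \<Rightarrow> real mat \<Rightarrow> real \<Rightarrow> real Matrix.vec set" where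
  "low_eigenvectors n Abar M r \<equiv> {v \<in> carrier_vec n. v \<noteq> 0\<^sub>v n \<and>
     (\<exists>y. 0 < y \<and> y < r \<and> Abar *\<^sub>v v = y \<cdot>\<^sub>v (M *\<^sub>v v))}"

lemma Ebar_decomposition:
  assumes "Abar \<in> spd_mats n" "x \<in> carrier_vec n"
  obtains e u where "e \<in> Ebar n Abar M r" "e \<in> carrier_vec n" "u \<in> Ebar_perp n Abar M r" "x = e + u"
proof -
  have X: "low_eigenvectors n Abar M r \<subseteq> carrier_vec n" by blast
  show ?thesis
  proof (rule spd_orthogonal_decomposition[OF assms(1) X assms(2)], fold Ebar_def)
    fix e u
    assume "e \<in> Ebar n Abar M r" "e \<in> carrier_vec n" "u \<in> carrier_vec n" "x = e + u"
      and "\<And>w. w \<in> Ebar n Abar M r \<Longrightarrow> u \<bullet> (Abar *\<^sub>v w) = 0"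
    then show ?thesis by (intro that[of e u]) (simp_all add: Ebar_perp_def)
  qed
qed

lemma Ebar_eigenvector_orthogonal:
  assumes "v \<in> low_eigenvectors n Abar M r" "u \<in> Ebar_perp n Abar M r"
  shows "u \<bullet> (Abar *\<^sub>v v) = 0"
proof -
  interpret vec_space "TYPE(real)" n .
  have "low_eigenvectors n Abar M r \<subseteq> span (low_eigenvectors n Abar M r)"
    by (rule in_own_span) auto
  then show ?thesis using assms unfolding Ebar_perp_def Ebar_def by blast
qed

lemma span_orthogonal:
  fixes X :: "real Matrix.vec set"
  assumes X: "X \<subseteq> carrier_vec n" and z: "z \<in> carrier_vec n"
    and orth: "\<And>v. v \<in> X \<Longrightarrow> z \<bullet> v = 0" and w: "w \<in> span_Rn n X"
  shows "z \<bullet> w = 0"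
proof -
  interpret vec_space "TYPE(real)" n .
  have "z \<in> orthogonal_complement X"
    using z orth by (simp add: orthogonal_complement_def)
  then have "z \<in> orthogonal_complement (span X)"
    using in_orthogonal_complement_span[OF X] by simp
  then show ?thesis using w by (simp add: orthogonal_complement_def)
qed

text \<open>On an eigenvector, \<open>Abar\<close> acts as \<open>y\<close> times \<open>M\<close>
  with \<open>y\<close> nonzero, so the two orthogonalities agree there; linearity extends this to
  the span.\<close>

lemma Ebar_perp_M_orthogonal:
  assumes Abar: "Abar \<in> carrier_mat n n" and M: "M \<in> sym_mats n"
    and u: "u \<in> Ebar_perp n Abar M r" and w: "w \<in> Ebar n Abar M r"
  shows "u \<bullet> (M *\<^sub>v w) = 0"
proof -
  note M1 = sym_matsD(1)[OF M]
  have uc: "u \<in> carrier_vec n" using u by (simp add: Ebar_perp_def)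
  interpret vec_space "TYPE(real)" n .
  have X: "low_eigenvectors n Abar M r \<subseteq> carrier_vec n" by blast
  have wc: "w \<in> carrier_vec n"
    by (rule subsetD[OF span_is_subset2[OF X] w[unfolded Ebar_def]])
  \<comment> \<open>Moving \<open>M\<close> to the left factor by symmetry leaves plain Euclidean
    orthogonality to a span.\<close>
  have "(M *\<^sub>v u) \<bullet> w = 0"
  proof (rule span_orthogonal[OF X _ _ w[unfolded Ebar_def]])
    fix v assume v: "v \<in> low_eigenvectors n Abar M r"
    then obtain y where y: "0 < y" "Abar *\<^sub>v v = y \<cdot>\<^sub>v (M *\<^sub>v v)" and vc: "v \<in> carrier_vec n"
      by blast
    have "y * (u \<bullet> (M *\<^sub>v v)) = 0"
      using Ebar_eigenvector_orthogonal[OF v u] y(2) uc vc M1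
      by (simp add: scalar_prod_smult_distrib[of _ n])
    then have "u \<bullet> (M *\<^sub>v v) = 0" using y(1) by simp
    then show "(M *\<^sub>v u) \<bullet> v = 0"
      using mult_mat_vec_scalar_prod[OF M1 uc vc] sym_matsD(2)[OF M] by simp
  qed (use M1 uc in simp)
  then show ?thesis
    using mult_mat_vec_scalar_prod[OF M1 uc wc] sym_matsD(2)[OF M] by simp
qed

text \<open>
  Otherwise the form restricted to the range of \<open>W\<close> has an eigenvalue below \<open>r\<close>. Its eigenvector
  is an eigenvector on the whole space, because the residual is orthogonal both to
  \<open>Ebar\<close> and to \<open>Ebar_perp\<close>; so it lies in both.
\<close>

lemma Ebar_perp_Rayleigh_quotient:
  assumes Abar: "Abar \<in> spd_mats n" and M: "M \<in> spd_mats n"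
    and u: "u \<in> Ebar_perp n Abar M r"
    and W: "W \<in> carrier_mat n k" and range: "Ebar_perp n Abar M r = (\<lambda>c. W *\<^sub>v c) ` carrier_vec k"
    and inj: "\<And>c. c \<in> carrier_vec k \<Longrightarrow> W *\<^sub>v c = 0\<^sub>v n \<Longrightarrow> c = 0\<^sub>v k"
  shows "r * (u \<bullet> (M *\<^sub>v u)) \<le> u \<bullet> (Abar *\<^sub>v u)"
proof (rule ccontr)
  assume neg: "\<not> r * (u \<bullet> (M *\<^sub>v u)) \<le> u \<bullet> (Abar *\<^sub>v u)"
  note A1 = spd_matsD[OF Abar] and M1 = spd_matsD[OF M]
  have AW: "W\<^sup>T * Abar * W \<in> spd_mats k" and MW: "W\<^sup>T * M * W \<in> spd_mats k"
    using inj W A1(3) M1(3)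
    by (auto intro!: spd_mats_congruence[OF A1(1) W] spd_mats_congruence[OF M1(1) W]
        intro: mult_mat_vec_carrier[OF W])
  note formA = congruence_scalar_prod[OF A1(2) W] and formM = congruence_scalar_prod[OF M1(2) W]
  obtain c where c: "c \<in> carrier_vec k" "u = W *\<^sub>v c" using u range by blast
  \<comment> \<open>In the coordinates of \<open>W\<close>, the violated inequality puts the
    Rayleigh quotient of the compressed pair at \<open>c\<close> below \<open>r\<close>.\<close>
  obtain y d where y: "0 < y" "y < r" and d: "d \<in> carrier_vec k" "d \<noteq> 0\<^sub>v k"
    and eig: "(W\<^sup>T * Abar * W) *\<^sub>v d = y \<cdot>\<^sub>v ((W\<^sup>T * M * W) *\<^sub>v d)"
  proof (rule generalized_eigenvector_below_Rayleigh_quotient[OF AW MW c(1)])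
    show "c \<bullet> ((W\<^sup>T * Abar * W) *\<^sub>v c) < r * (c \<bullet> ((W\<^sup>T * M * W) *\<^sub>v c))"
      using neg unfolding formA[OF c(1) c(1)] formM[OF c(1) c(1)] c(2) by simp
  qed
  let ?v = "W *\<^sub>v d"
  have v: "?v \<in> carrier_vec n" "?v \<noteq> 0\<^sub>v n" "?v \<in> Ebar_perp n Abar M r"
    using d inj W range by auto
  let ?z = "Abar *\<^sub>v ?v - y \<cdot>\<^sub>v (M *\<^sub>v ?v)"
  have zc: "?z \<in> carrier_vec n" using A1(2) M1(2) v(1) by simp
  have prod: "w \<bullet> ?z = w \<bullet> (Abar *\<^sub>v ?v) - y * (w \<bullet> (M *\<^sub>v ?v))" if "w \<in> carrier_vec n" for w
    using that A1(2) M1(2) v(1)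
    by (simp add: scalar_prod_minus_distrib[of _ n] scalar_prod_smult_distrib[of _ n])
  have perp: "w \<bullet> ?z = 0" if w: "w \<in> Ebar_perp n Abar M r" for w
  proof -
    obtain f where f: "f \<in> carrier_vec k" "w = W *\<^sub>v f"
      using w range by blast
    have "w \<in> carrier_vec n" using f W by simp
    have "f \<bullet> ((W\<^sup>T * Abar * W) *\<^sub>v d) = y * (f \<bullet> ((W\<^sup>T * M * W) *\<^sub>v d))"
      unfolding eig
      by (rule scalar_prod_smult_distrib[of _ k]) (use f(1) d(1) spd_matsD(2)[OF MW] in auto)
    with prod[OF \<open>w \<in> carrier_vec n\<close>] show ?thesis
      unfolding formA[OF f(1) d(1)] formM[OF f(1) d(1)] f(2) by linarith
  qed
  \<comment> \<open>The residual \<open>?z\<close> itself is split; both parts turn out orthogonal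
    to \<open>?z\<close>, whence \<open>?z \<bullet> ?z = 0\<close>.\<close>
  obtain e w where ew: "e \<in> Ebar n Abar M r" "e \<in> carrier_vec n" "w \<in> Ebar_perp n Abar M r" "?z = e + w"
    using Ebar_decomposition[OF Abar zc] by metis
  have wc: "w \<in> carrier_vec n" using ew(3) by (simp add: Ebar_perp_def)
  have "e \<bullet> (Abar *\<^sub>v ?v) = 0"
    using sym_mats_scalar_prod_commute[OF A1(1) ew(2) v(1)] v(3) ew(1) by (simp add: Ebar_perp_def)
  moreover have "e \<bullet> (M *\<^sub>v ?v) = 0"
    using sym_mats_scalar_prod_commute[OF M1(1) ew(2) v(1)]
      Ebar_perp_M_orthogonal[OF A1(2) M1(1) v(3) ew(1)] by simp
  ultimately have "e \<bullet> ?z = 0" using prod[OF ew(2)] by simp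
  then have "?z \<bullet> ?z = 0"
    using perp[OF ew(3)] add_scalar_prod_distrib[OF ew(2) wc zc] ew(4) by simp
  then have "?z = 0\<^sub>v n" by (rule scalar_prod_real_eq_0[OF zc])
  then have "Abar *\<^sub>v ?v = y \<cdot>\<^sub>v (M *\<^sub>v ?v)"
    by (rule vec_minus_eq_0D[rotated 2]) (use A1(2) M1(2) v(1) in auto)
  then have "?v \<in> low_eigenvectors n Abar M r" using v y by blast
  \<comment> \<open>\<open>?v\<close> lies in \<open>Ebar\<close> and in its complement, so it is
    \<open>Abar\<close>-orthogonal to itself.\<close>
  then have "?v \<bullet> (Abar *\<^sub>v ?v) = 0" by (rule Ebar_eigenvector_orthogonal[OF _ v(3)])
  then show False using A1(3)[OF v(1,2)] by simp
qed

section \<open>The correction formula\<close>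

theorem lemma4p2:
  fixes n d :: nat
    and S :: "real Matrix.vec set"
    and M Abar W :: "real mat"
    and A :: "nat \<Rightarrow> real mat"
    and \<alpha> \<beta> \<Lambda> \<rho> lam :: real
    and \<sigma> x :: "real Matrix.vec"
  assumes "bounded_in_Rn d S"
    and "M \<in> spd_mats n"
    and "\<And>m. m \<le> d \<Longrightarrow> A m \<in> sym_mats n"
    and "\<And>\<tau>. \<tau> \<in> S \<Longrightarrow> affine_mat n d A \<tau> \<in> spd_mats n"
    and "Abar \<in> spd_mats n"
    and "0 < \<alpha>" and "0 < \<beta>"
    and "spectrally_equivalent n S (affine_mat n d A) Abar \<alpha> \<beta>"
    and "0 < \<Lambda>"
    and "1 < \<rho>" and "1 < \<alpha> * \<rho>"
    and "\<sigma> \<in> S"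
    and "0 < lam" and "lam < \<Lambda>"
    and "x \<in> carrier_vec n" and "x \<noteq> 0\<^sub>v n"
    and "affine_mat n d A \<sigma> *\<^sub>v x = lam \<cdot>\<^sub>v (M *\<^sub>v x)"
    and "columns_form_basis n W (Ebar_perp n Abar M (\<rho> * \<Lambda>))"
  shows "\<exists>xbar \<in> Ebar n Abar M (\<rho> * \<Lambda>).
           x = xbar - correction_op (affine_mat n d A) Abar M W \<sigma> lam *\<^sub>v xbar"
proof -
  let ?A = "affine_mat n d A \<sigma>" and ?E = "Ebar n Abar M (\<rho> * \<Lambda>)"
    and ?U = "Ebar_perp n Abar M (\<rho> * \<Lambda>)"
  let ?Q = "?A - lam \<cdot>\<^sub>m M"
  let ?H = "W\<^sup>T * ?Q * W"
  have A1: "?A \<in> spd_mats n" using assms(4,12) .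
  note A = spd_matsD[OF A1] and Abar = spd_matsD[OF assms(5)] and M = spd_matsD[OF assms(2)]
  obtain k where W: "W \<in> carrier_mat n k"
    using assms(18) by (auto simp: columns_form_basis_def)
  have dist: "distinct (cols W)"
    and li: "lin_indpt_Rn n (set (cols W))" and sp: "span_Rn n (set (cols W)) = ?U"
    using assms(18) by (auto simp: columns_form_basis_def)
  have range: "?U = (\<lambda>c. W *\<^sub>v c) ` carrier_vec k"
    using span_cols_eq_range[OF W dist] sp by simp
  note inj = lin_indpt_cols_injective[OF W dist li]
  have Qsym: "?Q \<in> sym_mats n" by (rule sym_mats_minus_smult[OF A(1) M(1)])
  note Q1 = sym_matsD(1)[OF Qsym] and form = scalar_prod_minus_smult_mult_mat_vec[OF A(2) M(2)]
  have H: "?H \<in> spd_mats k"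
  proof (rule spd_mats_congruence[OF Qsym W])
    fix c :: "real Matrix.vec" assume c: "c \<in> carrier_vec k" "c \<noteq> 0\<^sub>v k"
    let ?u = "W *\<^sub>v c"
    have u: "?u \<in> carrier_vec n" "?u \<noteq> 0\<^sub>v n" "?u \<in> ?U"
      using mult_mat_vec_carrier[OF W c(1)] inj[OF c(1)] c range by blast+
    have Mu: "0 < ?u \<bullet> (M *\<^sub>v ?u)" using M(3)[OF u(1,2)] .
    \<comment> \<open>Strictness comes from \<open>lam < \<Lambda>\<close>; then
      \<open>1 < \<alpha> * \<rho>\<close>, the Rayleigh bound on the complement and the lower
      spectral bound are chained.\<close>
    have "lam * (?u \<bullet> (M *\<^sub>v ?u)) < \<Lambda> * (?u \<bullet> (M *\<^sub>v ?u))"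
      using assms(14) Mu by simp
    also have "\<dots> \<le> (\<alpha> * \<rho>) * (\<Lambda> * (?u \<bullet> (M *\<^sub>v ?u)))"
      using mult_pos_pos[OF assms(9) Mu] assms(11) by (simp add: mult_le_cancel_right1)
    also have "\<dots> = \<alpha> * (\<rho> * \<Lambda> * (?u \<bullet> (M *\<^sub>v ?u)))" by (simp add: ac_simps)
    also have "\<dots> \<le> \<alpha> * (?u \<bullet> (Abar *\<^sub>v ?u))"
      using Ebar_perp_Rayleigh_quotient[OF assms(5,2) u(3) W range inj] assms(6) by simp
    also have "\<dots> \<le> ?u \<bullet> (?A *\<^sub>v ?u)"
      using assms(8,12) u(1) unfolding spectrally_equivalent_def by blast
    finally show "0 < ?u \<bullet> (?Q *\<^sub>v ?u)" unfolding form[OF u(1) u(1)] by simp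
  qed
  note H1 = spd_matsD(2)[OF H]
  \<comment> \<open>Definiteness of \<open>?H\<close> makes \<open>mat_inverse\<close> a
    \<open>Some\<close>, so \<open>the\<close> in \<open>correction_op\<close> yields the true
    inverse.\<close>
  obtain B where B: "mat_inverse ?H = Some B" "B \<in> carrier_mat k k" "B * ?H = 1\<^sub>m k"
    using spd_mat_inverse[OF H] by metis
  obtain e u where e: "e \<in> ?E" "e \<in> carrier_vec n" and u: "u \<in> ?U" and x: "x = e + u"
    using Ebar_decomposition[OF assms(5,15)] by metis
  obtain c where c: "c \<in> carrier_vec k" and uc: "u = W *\<^sub>v c" using u range by blast
  have un: "u \<in> carrier_vec n" using W c uc by simp
  define b where "b = W\<^sup>T *\<^sub>v ((?A - Abar) *\<^sub>v e)"
  have D: "?A - Abar \<in> carrier_mat n n" by (rule minus_carrier_mat[OF Abar(2)])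
  have b: "b \<in> carrier_vec k" using W D e(2) by (simp add: b_def)
  have Z: "correction_op (affine_mat n d A) Abar M W \<sigma> lam *\<^sub>v e = W *\<^sub>v (B *\<^sub>v b)"
  proof -
    have "(W * B * W\<^sup>T * (?A - Abar)) *\<^sub>v e = (W * B * W\<^sup>T) *\<^sub>v ((?A - Abar) *\<^sub>v e)"
      by (rule assoc_mult_mat_vec[of _ n n _ n]) (use W B D e in auto)
    also have "\<dots> = (W * B) *\<^sub>v b"
      unfolding b_def by (rule assoc_mult_mat_vec[of _ n k _ n]) (use W B D e in auto)
    also have "\<dots> = W *\<^sub>v (B *\<^sub>v b)"
      by (rule assoc_mult_mat_vec[OF W B(2) b])
    finally show ?thesis by (simp only: correction_op_def B(1) option.sel)
  qed
  have Qx: "w \<bullet> (?Q *\<^sub>v x) = 0" if w: "w \<in> carrier_vec n" for w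
    using form[OF w assms(15), of lam] assms(17) M(2) w assms(15)
    by (simp add: scalar_prod_smult_distrib[of _ n])
  \<comment> \<open>The compressed eigenvalue equation, checked against every \<open>f\<close>, that
    is, against every vector \<open>W *\<^sub>v f\<close> of the complement.\<close>
  have "?H *\<^sub>v c + b = 0\<^sub>v k"
  proof (rule vec_eq_0_if_orthogonal_all)
    show "?H *\<^sub>v c + b \<in> carrier_vec k"
      by (rule add_carrier_vec[OF mult_mat_vec_carrier[OF H1 c] b])
    fix f :: "real Matrix.vec" assume f: "f \<in> carrier_vec k"
    let ?w = "W *\<^sub>v f"
    have w: "?w \<in> carrier_vec n" "?w \<in> ?U" using W f range by auto
    have "?w \<bullet> (?Q *\<^sub>v e) + ?w \<bullet> (?Q *\<^sub>v u) = 0"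
      using Qx[OF w(1)] Q1 e(2) un w(1)
      by (simp add: x mult_add_distrib_mat_vec[of _ n n] scalar_prod_add_distrib[of _ n])
    \<comment> \<open>The \<open>lam\<close> term vanishes by
      \<open>M\<close>-orthogonality.\<close>
    moreover have "?w \<bullet> (?Q *\<^sub>v e) = ?w \<bullet> (?A *\<^sub>v e)"
      using form[OF w(1) e(2), of lam] Ebar_perp_M_orthogonal[OF Abar(2) M(1) w(2) e(1)] by simp
    \<comment> \<open>\<open>Abar\<close>-orthogonality allows \<open>Abar\<close> to be subtracted
      at no cost; this brings in the difference \<open>?A - Abar\<close>.\<close>
    moreover have "?w \<bullet> ((?A - Abar) *\<^sub>v e) = ?w \<bullet> (?A *\<^sub>v e)"
    proof -
      have "?w \<bullet> (Abar *\<^sub>v e) = 0" using w(2) e(1) by (simp add: Ebar_perp_def)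
      then show ?thesis
        using A(2) Abar(2) e(2) w(1)
        by (simp add: minus_mult_distrib_mat_vec[of _ n n] scalar_prod_minus_distrib[of _ n])
    qed
    moreover have "f \<bullet> b = ?w \<bullet> ((?A - Abar) *\<^sub>v e)"
      unfolding b_def using mult_mat_vec_scalar_prod[OF W f, of "(?A - Abar) *\<^sub>v e"] D e(2) by simp
    moreover have "f \<bullet> (?H *\<^sub>v c) = ?w \<bullet> (?Q *\<^sub>v u)"
      unfolding uc by (rule congruence_scalar_prod[OF Q1 W f c])
    moreover have "f \<bullet> (?H *\<^sub>v c + b) = f \<bullet> (?H *\<^sub>v c) + f \<bullet> b"
      by (rule scalar_prod_add_distrib[OF f mult_mat_vec_carrier[OF H1 c] b])
    ultimately show "f \<bullet> (?H *\<^sub>v c + b) = 0" by linarith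
  qed
  moreover have zero: "X *\<^sub>v 0\<^sub>v k = 0\<^sub>v m" if "X \<in> carrier_mat m k" for X :: "real mat" and m
    using that by (intro eq_vecI) auto
  ultimately have "B *\<^sub>v (?H *\<^sub>v c + b) = 0\<^sub>v k" using B(2) by simp
  moreover have "B *\<^sub>v (?H *\<^sub>v c + b) = B *\<^sub>v (?H *\<^sub>v c) + B *\<^sub>v b"
    by (rule mult_add_distrib_mat_vec[OF B(2) mult_mat_vec_carrier[OF H1 c] b])
  moreover have "B *\<^sub>v (?H *\<^sub>v c) = c"
    using assoc_mult_mat_vec[OF B(2) H1 c] B(3) c by simp
  \<comment> \<open>This determines the coordinates of \<open>u\<close>; applying \<open>W\<close>
    shows that \<open>u\<close> is minus the correction operator applied to \<open>e\<close>, so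
    \<open>e\<close> serves as \<open>xbar\<close>.\<close>
  ultimately have "c + B *\<^sub>v b = 0\<^sub>v k" by simp
  then have "W *\<^sub>v (c + B *\<^sub>v b) = 0\<^sub>v n" using zero[OF W] by simp
  moreover have "W *\<^sub>v (c + B *\<^sub>v b) = u + W *\<^sub>v (B *\<^sub>v b)"
    unfolding uc by (rule mult_add_distrib_mat_vec[OF W c]) (use B(2) b in simp)
  ultimately have sum: "u + W *\<^sub>v (B *\<^sub>v b) = 0\<^sub>v n" by simp
  define z where "z = W *\<^sub>v (B *\<^sub>v b)"
  have z: "z \<in> carrier_vec n" using W B(2) b by (simp add: z_def)
  have "x = e - z"
  proof (rule eq_vecI)
    show "dim_vec x = dim_vec (e - z)" using assms(15) z by simp
    fix i assume "i < dim_vec (e - z)"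
    then have i: "i < n" using z by simp
    have "(u + z) $ i = 0" using sum i by (simp add: z_def)
    then show "x $ i = (e - z) $ i" using i e(2) un z by (simp add: x)
  qed
  then show ?thesis using e(1) Z unfolding z_def by metis
qed

end
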